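(* For almost every tensor $X\in\mathbb{R}^{2\times 2\times 2}$ (i.e. for a generic $X$), if $Y$ is a best rank-1 approximation of $X$, then $X-Y$ lies in the orbit $D_3$.
   Context: Tensors are real arrays $X=(X_{ijk})\in\mathbb{R}^{2\times2\times2}$. The slabs are the $2\times 2$ matrices $X_k$ with $(X_k)_{ij}=X_{ijk}$, $k=1,2$, and one writes $X=[X_1\,|\,X_2]$. The Frobenius norm is $\|X\|^2=\sum_{ijk}X_{ijk}^2$. For vectors $x,y,z\in\mathbb{R}^2$, $x\otimes y\otimes z$ is the tensor with entries $x_iy_jz_k$. A best rank-1 approximation of $X$ is a tensor $Y=x\otimes y\otimes z$ for which $(x,y,z)$ minimizes $\|X-x\otimes y\otimes z\|^2$ over $x,y,z\in\mathbb{R}^2$ (a minimizer always exists). For $2\times 2$ matrices $S,T,U$, $(S,T,U)\cdot X$ is the tensor with entries $\sum_{pqr}S_{ip}T_{jq}U_{kr}X_{pqr}$. The orbit $D_3$ is the set of all tensors $(S,T,U)\cdot C$ with $S,T,U$ real invertible $2\times2$ matrices, where $$C=\left[\begin{array}{cc|cc}0&1&1&0\\1&0&0&0\end{array}\right].$$ "Generic" and "almost every/almost all" refer to Lebesgue measure on $\mathbb{R}^{2\times2\times2}\cong\mathbb{R}^8$: the property holds for all $X$ outside a set of Lebesgue measure zero. *)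

theory Defs
  imports "HOL-Analysis.Analysis"
begin

text \<open>The entry \<open>X\<^sub>i\<^sub>j\<^sub>k\<close> is \<open>X $ i $ j $ k\<close>. The indices range over the
  two-element type \<open>2\<close>, whose elements are \<open>1\<close> and \<open>2\<close> (with \<open>2 = 0\<close>).\<close>

type_synonym tensor = "real^2^2^2"

text \<open>The library norm of the nested vector type is the Frobenius norm.\<close>

lemma norm_tensor_sq:
  fixes X :: tensor
  shows "(norm X)\<^sup>2 = (\<Sum>i\<in>UNIV. \<Sum>j\<in>UNIV. \<Sum>k\<in>UNIV. (X $ i $ j $ k)\<^sup>2)"
  by (simp add: norm_vec_def L2_set_def sum_nonneg)

definition from_slabs :: "real^2^2 \<Rightarrow> real^2^2 \<Rightarrow> tensor" where
  "from_slabs X1 X2 = (\<chi> i j k. if k = 1 then X1 $ i $ j else X2 $ i $ j)"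

definition outer3 :: "real^2 \<Rightarrow> real^2 \<Rightarrow> real^2 \<Rightarrow> tensor" where
  "outer3 x y z = (\<chi> i j k. x $ i * y $ j * z $ k)"

definition best_rank1_approx :: "tensor \<Rightarrow> tensor \<Rightarrow> bool" where
  "best_rank1_approx X Y \<longleftrightarrow>
     (\<exists>x y z. Y = outer3 x y z \<and>
        (\<forall>x' y' z'. (norm (X - outer3 x y z))\<^sup>2 \<le> (norm (X - outer3 x' y' z'))\<^sup>2))"

definition tensor_act :: "real^2^2 \<Rightarrow> real^2^2 \<Rightarrow> real^2^2 \<Rightarrow> tensor \<Rightarrow> tensor" where
  "tensor_act S T U X =
     (\<chi> i j k. \<Sum>p\<in>UNIV. \<Sum>q\<in>UNIV. \<Sum>r\<in>UNIV. S $ i $ p * T $ j $ q * U $ k $ r * X $ p $ q $ r)"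

definition D3_rep :: tensor where
  "D3_rep = from_slabs (vector [vector [0, 1], vector [1, 0]])
                       (vector [vector [1, 0], vector [0, 0]])"

definition D3 :: "tensor set" where
  "D3 = {tensor_act S T U D3_rep | S T U. invertible S \<and> invertible T \<and> invertible U}"

end

theory Submission
  imports Defs
begin

text \<open>Rotate each mode so that the best rank-1 approximation becomes
  \<open>l e\<^sub>1 \<otimes> e\<^sub>1 \<otimes> e\<^sub>1\<close>. By first-order stationarity the residual then has zero entries at
  positions 111, 112, 121, 211. It lies in the orbit as soon as its entries at 221, 212, 122 are
  nonzero. If one of them vanishes, the tensor is determined smoothly by seven parameters, namely
  three angles, \<open>l\<close>, and the three other entries of the residual, so the exceptional tensors lie
  in a null set of the eight-dimensional tensor space.\<close>

lemma tensor_act_nth: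
  "tensor_act S T U X $ i $ j $ k =
    (\<Sum>p\<in>UNIV. \<Sum>q\<in>UNIV. \<Sum>r\<in>UNIV. S $ i $ p * T $ j $ q * U $ k $ r * X $ p $ q $ r)"
  by (simp add: tensor_act_def)

lemma tensor_act_tensor_act:
  "tensor_act S T U (tensor_act S' T' U' X) = tensor_act (S ** S') (T ** T') (U ** U') X"
proof -
  have "tensor_act S T U (tensor_act S' T' U' X) $ i $ j $ k =
        tensor_act (S ** S') (T ** T') (U ** U') X $ i $ j $ k" for i j k
    by (simp only: tensor_act_nth matrix_matrix_mult_def vec_lambda_beta sum_2
        distrib_left distrib_right ac_simps)
  then show ?thesis by (simp add: vec_eq_iff)
qed

lemma tensor_act_id: "tensor_act (mat 1) (mat 1) (mat 1) X = X"
  by (simp add: vec_eq_iff tensor_act_nth forall_2 sum_2 mat_def)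

lemma tensor_act_outer3:
  "tensor_act S T U (outer3 x y z) = outer3 (S *v x) (T *v y) (U *v z)"
  by (simp add: vec_eq_iff tensor_act_nth outer3_def matrix_vector_mult_def sum_2 algebra_simps)

lemma tensor_act_add:
  "tensor_act S T U (X + Y) = tensor_act S T U X + tensor_act S T U Y"
  by (simp add: vec_eq_iff tensor_act_nth sum.distrib distrib_left)

lemma tensor_act_in_D3:
  assumes "invertible S" "invertible T" "invertible U" "X \<in> D3"
  shows "tensor_act S T U X \<in> D3"
proof -
  obtain S' T' U' where "X = tensor_act S' T' U' D3_rep"
    "invertible S'" "invertible T'" "invertible U'"
    using assms(4) by (auto simp: D3_def)
  then show ?thesis
    using assms(1-3) unfolding D3_def mem_Collect_eq
    by (metis tensor_act_tensor_act invertible_mult)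
qed

text \<open>A single angle per mode keeps the parameter count low and makes the dependence
  differentiable on all of the line.\<close>

definition rot :: "real \<Rightarrow> real^2^2" where
  "rot t = vector [vector [cos t, - sin t], vector [sin t, cos t]]"

lemma rot_mult_transpose: "rot t ** transpose (rot t) = mat 1"
  using sin_cos_squared_add[of t]
  by (simp add: vec_eq_iff forall_2 matrix_matrix_mult_def sum_2 rot_def transpose_def mat_def
      power2_eq_square add.commute)

lemma invertible_rot: "invertible (rot t)"
  using invertible_right_inverse rot_mult_transpose by blast

text \<open>These are polar coordinates. The zero vector is covered by r = 0, so a vanishing factor
  still gets a unit direction.\<close>

lemma rot_polar:
  fixes x :: "real^2"
  obtains r t where "x = r *\<^sub>R (rot t *v axis 1 1)"
proof -
  obtain r t where "x $ 1 = r * cos t" "x $ 2 = r * sin t"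
    using polar_Ex by blast
  then have "x = r *\<^sub>R (rot t *v axis 1 1)"
    by (simp add: vec_eq_iff forall_2 matrix_vector_mult_def sum_2 rot_def axis_def)
  then show ?thesis by (rule that)
qed

text \<open>The entries l, a, b, c, d sit at positions 111, 221, 212, 122, 222. Setting l = 0 gives
  the shape of a residual. The parameters form one tuple so that linearity and dimension can be
  stated directly.\<close>

definition core :: "real \<times> real \<times> real \<times> real \<times> real \<Rightarrow> tensor" where
  "core = (\<lambda>(l, a, b, c, d).
     from_slabs (vector [vector [l, 0], vector [0, a]]) (vector [vector [0, c], vector [b, d]]))"

lemma core_in_D3:
  assumes "a \<noteq> 0" "b \<noteq> 0" "c \<noteq> 0"
  shows "core (0, a, b, c, d) \<in> D3"
proof -
  \<comment> \<open>\<open>D3_rep\<close> is the sum of e1 e2 e1, e2 e1 e1 and e1 e1 e2 (tensor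
    products). The columns of S, T, U turn these terms into c e1 e2 e2, b e2 e1 e2 and e2 e2 (a e1 +
    d e2). The determinants are -c, -b and -a.\<close>
  define S T U :: "real^2^2" where
    "S = vector [vector [0, c], vector [1, 0]]" and
    "T = vector [vector [0, b], vector [1, 0]]" and
    "U = vector [vector [0, a], vector [1, d]]"
  have "core (0, a, b, c, d) = tensor_act S T U D3_rep"
    by (simp add: vec_eq_iff forall_2 sum_2 tensor_act_nth core_def D3_rep_def from_slabs_def
        S_def T_def U_def)
  moreover have "invertible S" "invertible T" "invertible U"
    using assms by (simp_all add: invertible_det_nz det_2 S_def T_def U_def)
  ultimately show ?thesis
    unfolding D3_def by blast
qed

lemma linear_core: "linear core"
  by (rule linearI)
    (auto simp: core_def from_slabs_def vec_eq_iff forall_2)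

text \<open>Each basis vector is some \<open>axis i b\<close>, so the coordinates of f x are inner
  products of \<open>f x $ i\<close> with basis vectors. Applied once per index level.\<close>

lemma differentiable_vec_lambda:
  fixes f :: "'a::euclidean_space \<Rightarrow> 'b::euclidean_space ^ 'n"
  assumes "\<And>i. (\<lambda>x. f x $ i) differentiable at a within S"
  shows "f differentiable at a within S"
  using assms
  by (subst differentiable_componentwise_within)
    (auto simp: Basis_vec_def inner_axis intro!: differentiable_inner)

lemma differentiable_vec_nth:
  assumes "f differentiable F"
  shows "(\<lambda>x. f x $ i) differentiable F"
  using assms bounded_linear.has_derivative[OF bounded_linear_vec_nth]
  unfolding differentiable_def by blast

lemma differentiable_tensor_act:
  fixes S T U :: "'a::euclidean_space \<Rightarrow> real^2^2"
  assumes "S differentiable at x" "T differentiable at x" "U differentiable at x"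
    "X differentiable at x"
  shows "(\<lambda>x. tensor_act (S x) (T x) (U x) (X x)) differentiable at x"
  unfolding tensor_act_def
  by (rule differentiable_vec_lambda)+
    (auto intro!: differentiable_sum differentiable_mult differentiable_vec_nth assms)

lemma differentiable_rot: "rot differentiable at t"
proof -
  have "(\<lambda>t. sin t) differentiable at t" "(\<lambda>t. cos t) differentiable at t"
    unfolding real_differentiable_def using DERIV_sin DERIV_cos by blast+
  then have "(\<lambda>t. rot t $ i $ j) differentiable at t" for i j
    using exhaust_2[of i] exhaust_2[of j]
    by (auto simp: rot_def)
  then show ?thesis
    by (intro differentiable_vec_lambda)
qed

text \<open>Three angles and at most four linear parameters make a domain of dimension at most 7,
  and a differentiable map from it into 8-dimensional space has null image.\<close>

lemma negligible_rot_act_linear_image: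
  fixes K :: "'a::euclidean_space \<Rightarrow> tensor"
  assumes "linear K" "DIM('a) \<le> 4"
  shows "negligible (range (\<lambda>(r, s, t, p). tensor_act (rot r) (rot s) (rot t) (K p)))"
proof (rule negligible_differentiable_image_lowdim)
  show "DIM(real \<times> real \<times> real \<times> 'a) < DIM(tensor)"
    using assms(2) by simp
  have rot: "(\<lambda>x. rot (f x)) differentiable at x" if "bounded_linear f"
    for f :: "real \<times> real \<times> real \<times> 'a \<Rightarrow> real" and x
    using differentiable_chain_at[OF bounded_linear_imp_differentiable[OF that] differentiable_rot]
    by (simp add: o_def)
  show "(\<lambda>(r, s, t, p). tensor_act (rot r) (rot s) (rot t) (K p)) differentiable_on UNIV"
    unfolding differentiable_on_def case_prod_beta'
    by (intro ballI differentiable_tensor_act rot bounded_linear_imp_differentiable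
        bounded_linear_compose[OF linear_conv_bounded_linear[THEN iffD1, OF assms(1)]]
        bounded_linear_intros)
qed

lemma inner_zero_if_norm_minimal:
  fixes R W :: "'a::real_inner"
  assumes "\<And>s. norm R \<le> norm (R - s *\<^sub>R W)"
  shows "R \<bullet> W = 0"
proof (cases "W = 0")
  case False
  \<comment> \<open>This s minimizes the quadratic s \<mapsto> |R - s W|^2.\<close>
  define s where "s = (R \<bullet> W) / (W \<bullet> W)"
  have "(norm R)\<^sup>2 \<le> (norm (R - s *\<^sub>R W))\<^sup>2"
    using assms by (simp add: power_mono)
  also have "\<dots> = (norm R)\<^sup>2 - (R \<bullet> W)\<^sup>2 / (W \<bullet> W)"
    unfolding power2_norm_eq_inner using False
    by (simp add: inner_diff inner_commute[of W R] s_def field_simps power2_eq_square)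
  finally have "\<not> 0 < (R \<bullet> W)\<^sup>2 / (W \<bullet> W)"
    by simp
  then show ?thesis
    using False by (simp add: zero_less_divide_iff)
qed simp

lemma outer3_add:
  "outer3 (x + x') y z = outer3 x y z + outer3 x' y z"
  "outer3 x (y + y') z = outer3 x y z + outer3 x y' z"
  "outer3 x y (z + z') = outer3 x y z + outer3 x y z'"
  by (simp_all add: outer3_def vec_eq_iff algebra_simps)

lemma outer3_scaleR:
  "outer3 (s *\<^sub>R x) y z = s *\<^sub>R outer3 x y z"
  "outer3 x (s *\<^sub>R y) z = s *\<^sub>R outer3 x y z"
  "outer3 x y (s *\<^sub>R z) = s *\<^sub>R outer3 x y z"
  by (simp_all add: outer3_def vec_eq_iff)

text \<open>Changing one factor moves the approximation along a straight line of rank-1 tensors.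
  Keeping l apart from x, y, z lets these directions be built from unit vectors even when the
  approximation is 0.\<close>

lemma best_rank1_stationary:
  assumes "best_rank1_approx X (l *\<^sub>R outer3 x y z)"
  shows "(X - l *\<^sub>R outer3 x y z) \<bullet> outer3 w y z = 0"
    and "(X - l *\<^sub>R outer3 x y z) \<bullet> outer3 x w z = 0"
    and "(X - l *\<^sub>R outer3 x y z) \<bullet> outer3 x y w = 0"
proof -
  have min: "norm (X - l *\<^sub>R outer3 x y z) \<le> norm (X - outer3 x' y' z')" for x' y' z'
    using assms by (auto simp: best_rank1_approx_def)
  show "(X - l *\<^sub>R outer3 x y z) \<bullet> outer3 w y z = 0"
    \<comment> \<open>The scalar l is absorbed into the varied factor; the placeholder is the step
      length along w.\<close>
    using min[of "l *\<^sub>R x + _ *\<^sub>R w" y z]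
    by (intro inner_zero_if_norm_minimal) (simp add: outer3_add outer3_scaleR diff_diff_eq)
  show "(X - l *\<^sub>R outer3 x y z) \<bullet> outer3 x w z = 0"
    using min[of x "l *\<^sub>R y + _ *\<^sub>R w" z]
    by (intro inner_zero_if_norm_minimal) (simp add: outer3_add outer3_scaleR diff_diff_eq)
  show "(X - l *\<^sub>R outer3 x y z) \<bullet> outer3 x y w = 0"
    using min[of x y "l *\<^sub>R z + _ *\<^sub>R w"]
    by (intro inner_zero_if_norm_minimal) (simp add: outer3_add outer3_scaleR diff_diff_eq)
qed

text \<open>By adjointness, this turns orthogonality to rank-1 tensors into vanishing entries in
  rotated coordinates.\<close>

lemma tensor_act_transpose_nth:
  "tensor_act (transpose S) (transpose T) (transpose U) X $ i $ j $ k =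
    X \<bullet> outer3 (S *v axis i 1) (T *v axis j 1) (U *v axis k 1)"
  by (simp add: tensor_act_nth transpose_def inner_vec_def outer3_def matrix_vector_mult_basis
      column_def ac_simps sum_distrib_left)

lemma best_rank1_core:
  assumes "best_rank1_approx X Y"
  obtains r s t l a b c d where
    "X = tensor_act (rot r) (rot s) (rot t) (core (l, a, b, c, d))"
    "X - Y = tensor_act (rot r) (rot s) (rot t) (core (0, a, b, c, d))"
proof -
  obtain x y z where Y: "Y = outer3 x y z"
    using assms by (auto simp: best_rank1_approx_def)
  obtain l1 r where x: "x = l1 *\<^sub>R (rot r *v axis 1 1)" by (rule rot_polar)
  obtain l2 s where y: "y = l2 *\<^sub>R (rot s *v axis 1 1)" by (rule rot_polar)
  obtain l3 t where z: "z = l3 *\<^sub>R (rot t *v axis 1 1)" by (rule rot_polar)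
  define l where "l = l1 * l2 * l3"
  have Yl: "Y = l *\<^sub>R outer3 (rot r *v axis 1 1) (rot s *v axis 1 1) (rot t *v axis 1 1)"
    by (simp add: Y x y z l_def outer3_scaleR)
  define Z where "Z = tensor_act (transpose (rot r)) (transpose (rot s)) (transpose (rot t)) (X - Y)"
  \<comment> \<open>Here w is the first or second column of the rotation in the varied mode.\<close>
  have "Z $ 1 $ 1 $ 1 = 0" "Z $ 2 $ 1 $ 1 = 0" "Z $ 1 $ 2 $ 1 = 0" "Z $ 1 $ 1 $ 2 = 0"
    using best_rank1_stationary[OF assms[unfolded Yl]]
    by (simp_all add: Z_def tensor_act_transpose_nth Yl)
  then obtain a b c d where "Z = core (0, a, b, c, d)"
    by (intro that[of "Z $ 2 $ 2 $ 1" "Z $ 2 $ 1 $ 2" "Z $ 1 $ 2 $ 2" "Z $ 2 $ 2 $ 2"])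
      (simp add: vec_eq_iff forall_2 core_def from_slabs_def)
  then have R: "X - Y = tensor_act (rot r) (rot s) (rot t) (core (0, a, b, c, d))"
    by (metis Z_def rot_mult_transpose tensor_act_id tensor_act_tensor_act)
  have "Y = tensor_act (rot r) (rot s) (rot t) (outer3 (l *\<^sub>R axis 1 1) (axis 1 1) (axis 1 1))"
    by (simp add: Yl tensor_act_outer3 matrix_vector_mult_scaleR flip: outer3_scaleR(1))
  moreover have "core (l, a, b, c, d) = core (0, a, b, c, d) +
      outer3 (l *\<^sub>R axis 1 1) (axis 1 1) (axis 1 1)"
    by (simp add: vec_eq_iff forall_2 core_def from_slabs_def outer3_def axis_def)
  ultimately have "X = tensor_act (rot r) (rot s) (rot t) (core (l, a, b, c, d))"
    using R by (metis diff_add_cancel tensor_act_add)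
  then show ?thesis using R by (rule that)
qed

theorem theorem4p1:
  shows "AE X :: tensor in lebesgue. \<forall>Y. best_rank1_approx X Y \<longrightarrow> X - Y \<in> D3"
proof -
  \<comment> \<open>K embeds four parameters as those core tuples in which a, b or c is 0.\<close>
  define F where "F K = range (\<lambda>(r, s, t, p). tensor_act (rot r) (rot s) (rot t) (core (K p)))"
    for K :: "real \<times> real \<times> real \<times> real \<Rightarrow> real \<times> real \<times> real \<times> real \<times> real"
  define K1 K2 K3 :: "real \<times> real \<times> real \<times> real \<Rightarrow> real \<times> real \<times> real \<times> real \<times> real" where
    "K1 = (\<lambda>(l, b, c, d). (l, 0, b, c, d))" and
    "K2 = (\<lambda>(l, a, c, d). (l, a, 0, c, d))" and
    "K3 = (\<lambda>(l, a, b, d). (l, a, b, 0, d))"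
  have "negligible (F K)" if "linear K" for K
    unfolding F_def using negligible_rot_act_linear_image[OF linear_compose[OF that linear_core]]
    by (simp add: o_def)
  moreover have "linear K1" "linear K2" "linear K3"
    by (auto intro!: linearI simp: K1_def K2_def K3_def)
  ultimately have "negligible (F K1 \<union> F K2 \<union> F K3)"
    by (intro negligible_Un)
  moreover have "X \<in> F K1 \<union> F K2 \<union> F K3"
    if best: "best_rank1_approx X Y" and notin: "X - Y \<notin> D3" for X Y
  proof -
    obtain r s t l a b c d where
      X: "X = tensor_act (rot r) (rot s) (rot t) (core (l, a, b, c, d))" and
      R: "X - Y = tensor_act (rot r) (rot s) (rot t) (core (0, a, b, c, d))"
      using best by (rule best_rank1_core)
    \<comment> \<open>The rotations are invertible and so preserve \<open>D3\<close>; the failure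
      must already occur for the core.\<close>
    have "core (0, a, b, c, d) \<notin> D3"
      using notin R by (metis invertible_rot tensor_act_in_D3)
    then consider "a = 0" | "b = 0" | "c = 0"
      using core_in_D3 by blast
    then show ?thesis
    proof cases
      case 1
      then have "X \<in> F K1"
        unfolding F_def K1_def X by (auto intro!: image_eqI[where x = "(r, s, t, l, b, c, d)"])
      then show ?thesis by simp
    next
      case 2
      then have "X \<in> F K2"
        unfolding F_def K2_def X by (auto intro!: image_eqI[where x = "(r, s, t, l, a, c, d)"])
      then show ?thesis by simp
    next
      case 3
      then have "X \<in> F K3"
        unfolding F_def K3_def X by (auto intro!: image_eqI[where x = "(r, s, t, l, a, b, d)"])
      then show ?thesis by simp
    qed
  qed
  ultimately show ?thesis
    by (intro AE_I'[of "F K1 \<union> F K2 \<union> F K3"]) (auto simp: negligible_iff_null_sets)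
qed

end
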